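(* Let $W=G(d,1,n)$. For any $w\in W$, the set $R(w)$ of reduced expressions for $w$ has exactly one equivalence class under $\approx$.
   Context: For positive integers $d,n$, $G(d,1,n)$ is the group generated by $S=\{s_1,\dots,s_n\}$ with defining relations $s_n^d=1$; $s_i^2=1$ $(1\le i\le n-1)$; $s_is_j=s_js_i$ $(j+1<i\le n)$; $s_{i+1}s_is_{i+1}=s_is_{i+1}s_i$ $(1\le i\le n-2)$; $s_ns_{n-1}s_ns_{n-1}=s_{n-1}s_ns_{n-1}s_n$ (the last relation being omitted if $n=1$). $S^\star$ is the free monoid of all finite words in the letters of $S$, with concatenation. $R(w)\subset S^\star$ is the set of reduced expressions for $w$, i.e. words of minimal length in $S^\star$ representing $w$. $\approx$ is the equivalence relation on $S^\star$ generated by replacing, inside a word, a subword (of consecutive letters) equal to one side of one of the following relations by the other side: $s_is_j=s_js_i$ for $j+1<i\le n$; $s_{i+1}s_is_{i+1}=s_is_{i+1}s_i$ for $1\le i\le n-2$; $s_n^{k_1}s_{n-1}s_n^{k_2}s_{n-1}=s_{n-1}s_n^{k_2}s_{n-1}s_n^{k_1}$ for $1\le k_1,k_2<d$. *)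

theory Defs
  imports "HOL-Algebra.Group"
begin

text \<open>
  A word over signed letters: \<open>(a, True)\<close> stands for the generator \<open>a\<close>,
  \<open>(a, False)\<close> for its formal inverse.
\<close>

type_synonym 'a sword = "('a \<times> bool) list"

definition swords :: "'a set \<Rightarrow> 'a sword set" where
  "swords S = lists (S \<times> UNIV)"

inductive_set pres_cong :: "'a set \<Rightarrow> ('a sword \<times> 'a sword) set \<Rightarrow> ('a sword \<times> 'a sword) set"
  for S :: "'a set" and Q :: "('a sword \<times> 'a sword) set"
where
  rel: "(u, v) \<in> Q \<Longrightarrow> u \<in> swords S \<Longrightarrow> v \<in> swords S \<Longrightarrow> (u, v) \<in> pres_cong S Q"
| cancel: "a \<in> S \<Longrightarrow> ([(a, b), (a, \<not> b)], []) \<in> pres_cong S Q"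
| refl: "u \<in> swords S \<Longrightarrow> (u, u) \<in> pres_cong S Q"
| sym: "(u, v) \<in> pres_cong S Q \<Longrightarrow> (v, u) \<in> pres_cong S Q"
| trans: "(u, v) \<in> pres_cong S Q \<Longrightarrow> (v, w) \<in> pres_cong S Q \<Longrightarrow> (u, w) \<in> pres_cong S Q"
| append: "(u, v) \<in> pres_cong S Q \<Longrightarrow> (u', v') \<in> pres_cong S Q \<Longrightarrow>
           (u @ u', v @ v') \<in> pres_cong S Q"

text \<open>
  The group \<open>\<langle>S | Q\<rangle>\<close>. The union over representatives in the product is a single
  class, because \<open>pres_cong S Q\<close> is a congruence.
\<close>

definition presented_group ::
  "'a set \<Rightarrow> ('a sword \<times> 'a sword) set \<Rightarrow> 'a sword set monoid" where
  "presented_group S Q =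
     \<lparr>carrier = swords S // pres_cong S Q,
      mult = (\<lambda>A B. \<Union>u\<in>A. \<Union>v\<in>B. pres_cong S Q `` {u @ v}),
      one = pres_cong S Q `` {[]}\<rparr>"

lemma pres_cong_swords:
  "(u, v) \<in> pres_cong S Q \<Longrightarrow> u \<in> swords S \<and> v \<in> swords S"
  by (induction rule: pres_cong.induct) (auto simp: swords_def)

lemma equiv_pres_cong: "equiv (swords S) (pres_cong S Q)"
proof (rule equivI)
  show "pres_cong S Q \<subseteq> swords S \<times> swords S"
    using pres_cong_swords by auto
  show "refl_on (swords S) (pres_cong S Q)"
    by (simp add: refl_on_def pres_cong.refl)
  show "sym (pres_cong S Q)"
    by (rule symI) (rule pres_cong.sym)
  show "trans (pres_cong S Q)"
    by (rule transI) (rule pres_cong.trans)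
qed

lemma presented_group_mult:
  assumes "u \<in> swords S" "v \<in> swords S"
  shows "pres_cong S Q `` {u} \<otimes>\<^bsub>presented_group S Q\<^esub> pres_cong S Q `` {v}
         = pres_cong S Q `` {u @ v}"
proof -
  have "pres_cong S Q `` {u' @ v'} = pres_cong S Q `` {u @ v}"
    if "(u, u') \<in> pres_cong S Q" "(v, v') \<in> pres_cong S Q" for u' v'
    by (rule equiv_class_eq[OF equiv_pres_cong pres_cong.append[OF that], symmetric])
  then have "(\<Union>u'\<in>pres_cong S Q `` {u}. \<Union>v'\<in>pres_cong S Q `` {v}. pres_cong S Q `` {u' @ v'})
      = (\<Union>u'\<in>pres_cong S Q `` {u}. \<Union>v'\<in>pres_cong S Q `` {v}. pres_cong S Q `` {u @ v})"
    by (intro SUP_cong HOL.refl) (simp only: Image_singleton_iff)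
  also have "\<dots> = pres_cong S Q `` {u @ v}"
    using pres_cong.refl[OF assms(1), of Q] pres_cong.refl[OF assms(2), of Q] by blast
  finally show ?thesis
    by (simp add: presented_group_def)
qed

lemma pres_cong_inverse:
  "u \<in> swords S \<Longrightarrow> (rev (map (\<lambda>(a, b). (a, \<not> b)) u) @ u, []) \<in> pres_cong S Q"
proof (induction u)
  case Nil
  then show ?case by (auto intro: pres_cong.refl)
next
  case (Cons x u)
  obtain a b where x: "x = (a, b)" by force
  have a: "a \<in> S" and u: "u \<in> swords S"
    using Cons.prems by (auto simp: swords_def x)
  let ?r = "rev (map (\<lambda>(a, b). (a, \<not> b)) u)"
  have r: "?r \<in> swords S"
    using u by (auto simp: swords_def in_lists_conv_set split_beta)
  have "([(a, \<not> b), (a, b)] @ u, [] @ u) \<in> pres_cong S Q"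
    using pres_cong.cancel[OF a, of "\<not> b"] pres_cong.refl[OF u]
    by (metis pres_cong.append)
  from pres_cong.append[OF pres_cong.refl[OF r] this]
  have "(?r @ [(a, \<not> b), (a, b)] @ u, ?r @ u) \<in> pres_cong S Q" by simp
  from pres_cong.trans[OF this Cons.IH[OF u]] show ?case by (simp add: x)
qed

lemma group_presented_group: "group (presented_group S Q)"
proof (rule groupI)
  let ?G = "presented_group S Q"
  have carrier: "x \<in> carrier ?G \<longleftrightarrow> (\<exists>u\<in>swords S. x = pres_cong S Q `` {u})" for x
    by (auto simp: presented_group_def quotient_def)
  have one: "\<one>\<^bsub>?G\<^esub> = pres_cong S Q `` {[]}"
    by (simp add: presented_group_def)
  have app: "u @ v \<in> swords S" if "u \<in> swords S" "v \<in> swords S" for u v :: "'a sword"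
    using that by (simp add: swords_def)
  have nil: "[] \<in> swords S"
    by (simp add: swords_def)
  show "x \<otimes>\<^bsub>?G\<^esub> y \<in> carrier ?G" if "x \<in> carrier ?G" "y \<in> carrier ?G" for x y
  proof -
    obtain u v where "u \<in> swords S" "v \<in> swords S"
      "x = pres_cong S Q `` {u}" "y = pres_cong S Q `` {v}"
      using \<open>x \<in> carrier ?G\<close> \<open>y \<in> carrier ?G\<close> unfolding carrier by blast
    then show ?thesis
      unfolding carrier by (intro bexI[of _ "u @ v"]) (simp_all only: presented_group_mult app)
  qed
  show "\<one>\<^bsub>?G\<^esub> \<in> carrier ?G"
    using nil by (auto simp: carrier one)
  show "x \<otimes>\<^bsub>?G\<^esub> y \<otimes>\<^bsub>?G\<^esub> z = x \<otimes>\<^bsub>?G\<^esub> (y \<otimes>\<^bsub>?G\<^esub> z)"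
    if "x \<in> carrier ?G" "y \<in> carrier ?G" "z \<in> carrier ?G" for x y z
    using that by (auto simp: carrier presented_group_mult app)
  show "\<one>\<^bsub>?G\<^esub> \<otimes>\<^bsub>?G\<^esub> x = x" if "x \<in> carrier ?G" for x
    using that nil by (auto simp: carrier one presented_group_mult)
  show "\<exists>y\<in>carrier ?G. y \<otimes>\<^bsub>?G\<^esub> x = \<one>\<^bsub>?G\<^esub>" if x: "x \<in> carrier ?G" for x
  proof -
    obtain u where u: "u \<in> swords S" "x = pres_cong S Q `` {u}"
      using x carrier by auto
    let ?r = "rev (map (\<lambda>(a, b). (a, \<not> b)) u)"
    have r: "?r \<in> swords S"
      using u by (auto simp: swords_def in_lists_conv_set split_beta)
    have "pres_cong S Q `` {?r} \<otimes>\<^bsub>?G\<^esub> x = \<one>\<^bsub>?G\<^esub>"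
      unfolding u(2) one presented_group_mult[OF r u(1)]
      by (rule equiv_class_eq[OF equiv_pres_cong pres_cong_inverse[OF u(1)]])
    moreover have "pres_cong S Q `` {?r} \<in> carrier ?G"
      using r by (auto simp only: carrier)
    ultimately show ?thesis by (rule bexI)
  qed
qed

text \<open>
  The letter \<open>s\<^sub>i\<close> is the natural number \<open>i\<close>, so \<open>S = {1..n}\<close> and
  \<open>S\<^sup>\<star> = lists {1..n}\<close>.
\<close>

definition G_rels :: "nat \<Rightarrow> nat \<Rightarrow> (nat list \<times> nat list) set" where
  "G_rels d n =
     {(replicate d n, [])}
     \<union> {([i, i], []) | i. 1 \<le> i \<and> i \<le> n - 1}
     \<union> {([i, j], [j, i]) | i j. 1 \<le> j \<and> j + 1 < i \<and> i \<le> n}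
     \<union> {([i + 1, i, i + 1], [i, i + 1, i]) | i. 1 \<le> i \<and> i + 2 \<le> n}
     \<union> (if 2 \<le> n then {([n, n - 1, n, n - 1], [n - 1, n, n - 1, n])} else {})"

definition pos_word :: "'a list \<Rightarrow> 'a sword" where
  "pos_word u = map (\<lambda>a. (a, True)) u"

definition G_group :: "nat \<Rightarrow> nat \<Rightarrow> nat sword set monoid" where
  "G_group d n = presented_group {1..n} (map_prod pos_word pos_word ` G_rels d n)"

definition G_gen :: "nat \<Rightarrow> nat \<Rightarrow> nat \<Rightarrow> nat sword set" where
  "G_gen d n i =
     pres_cong {1..n} (map_prod pos_word pos_word ` G_rels d n) `` {pos_word [i]}"

definition word_value :: "nat \<Rightarrow> nat \<Rightarrow> nat list \<Rightarrow> nat sword set" where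
  "word_value d n u =
     foldr (\<lambda>i x. G_gen d n i \<otimes>\<^bsub>G_group d n\<^esub> x) u \<one>\<^bsub>G_group d n\<^esub>"

definition reduced_exprs :: "nat \<Rightarrow> nat \<Rightarrow> nat sword set \<Rightarrow> nat list set" where
  "reduced_exprs d n w =
     {u \<in> lists {1..n}. word_value d n u = w \<and>
        (\<forall>v \<in> lists {1..n}. word_value d n v = w \<longrightarrow> length u \<le> length v)}"

definition braid_rels :: "nat \<Rightarrow> nat \<Rightarrow> (nat list \<times> nat list) set" where
  "braid_rels d n =
     {([i, j], [j, i]) | i j. 1 \<le> j \<and> j + 1 < i \<and> i \<le> n}
     \<union> {([i + 1, i, i + 1], [i, i + 1, i]) | i. 1 \<le> i \<and> i + 2 \<le> n}
     \<union> {(replicate k1 n @ [n - 1] @ replicate k2 n @ [n - 1],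
         [n - 1] @ replicate k2 n @ [n - 1] @ replicate k1 n) | k1 k2.
         2 \<le> n \<and> 1 \<le> k1 \<and> k1 < d \<and> 1 \<le> k2 \<and> k2 < d}"

definition braid_step :: "nat \<Rightarrow> nat \<Rightarrow> (nat list \<times> nat list) set" where
  "braid_step d n =
     {(x @ l @ y, x @ r @ y) | x l r y.
        x \<in> lists {1..n} \<and> y \<in> lists {1..n} \<and> (l, r) \<in> braid_rels d n}"

definition braid_equiv :: "nat \<Rightarrow> nat \<Rightarrow> (nat list \<times> nat list) set" where
  "braid_equiv d n =
     Restr ((braid_step d n \<union> (braid_step d n)\<inverse>)\<^sup>*) (lists {1..n})"

lemma equiv_braid_equiv: "equiv (lists {1..n}) (braid_equiv d n)"
proof -
  let ?r = "(braid_step d n \<union> (braid_step d n)\<inverse>)\<^sup>*"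
  have "sym ?r"
    by (intro sym_rtrancl) (auto intro: symI)
  moreover have "trans ?r"
    by (rule trans_rtrancl)
  ultimately show ?thesis
    unfolding braid_equiv_def equiv_def refl_on_def sym_def trans_def by blast
qed

end

theory Submission
  imports Defs "HOL-Combinatorics.Transposition"
begin

text \<open>
  The proof compares every reduced expression with a normal form. Write \<open>W\<^sub>m\<close> for the subgroup
  generated by \<open>s\<^sub>m, \<dots>, s\<^sub>n\<close>, with \<open>W\<^sub>1 = W\<close> and \<open>W\<^sub>n\<^sub>+\<^sub>1\<close> trivial. The
  right cosets of \<open>W\<^sub>m\<^sub>+\<^sub>1\<close> in \<open>W\<^sub>m\<close> have as representatives the words
  \<open>s\<^sub>m \<dots> s\<^sub>j\<^sub>-\<^sub>1\<close> and \<open>s\<^sub>m \<dots> s\<^sub>n\<^sub>-\<^sub>1 s\<^sub>n\<^sup>k s\<^sub>n\<^sub>-\<^sub>1 \<dots> s\<^sub>j\<close>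
  with \<open>m \<le> j \<le> n\<close> and \<open>1 \<le> k < d\<close>. A normal word is a product of such representatives, one for each
  \<open>m\<close>, with the representative of level \<open>1\<close> rightmost.

  Two facts suffice.

  Existence (\<open>reduces_to_normal\<close>): every word can be brought to a normal one using only
  the relations generating \<open>\<approx>\<close> and the deletions \<open>s\<^sub>i s\<^sub>i \<rightarrow> 1\<close> and
  \<open>s\<^sub>n\<^sup>d \<rightarrow> 1\<close>. The point is that these moves never lengthen a word. It is enough to
  multiply a representative \<open>r\<close> of level \<open>m\<close> on the right by one letter \<open>s\<close>
  (\<open>coset_rep_step\<close>): either \<open>r s\<close> turns into another representative, or \<open>s\<close>
  travels through \<open>r\<close> and comes out on the left as a letter of \<open>W\<^sub>m\<^sub>+\<^sub>1\<close>, to be absorbed by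
  the representatives of higher level.

  Uniqueness (\<open>normal_unique\<close>): different normal words have different values. The group acts on
  coloured points \<open>(p, c)\<close>, where \<open>s\<^sub>i\<close> exchanges the positions \<open>i\<close> and \<open>i + 1\<close> for
  \<open>i < n\<close>, and \<open>s\<^sub>n\<close> rotates the colour at position \<open>n\<close>; this is the action of monomial
  matrices on multiples of basis vectors. The image of \<open>(m, 0)\<close> under an element of \<open>W\<^sub>m\<close>
  determines its representative of level \<open>m\<close>, because \<open>W\<^sub>m\<^sub>+\<^sub>1\<close> fixes that point.

  Let \<open>u\<close> be a reduced expression for \<open>w\<close>. It reduces to a normal word with value \<open>w\<close>,
  and by minimality of \<open>u\<close> no deletion can occur on the way; hence \<open>u\<close> is
  \<open>\<approx>\<close>-equivalent to the normal word for \<open>w\<close>, which is the same for all \<open>u\<close>.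
\<close>

section \<open>Values of words\<close>

context
  fixes d n :: nat
  assumes d_pos: "1 \<le> d" and n_pos: "1 \<le> n"
begin

interpretation G: group "G_group d n"
  unfolding G_group_def by (rule group_presented_group)

abbreviation val :: "nat list \<Rightarrow> nat sword set" where
  "val \<equiv> word_value d n"

abbreviation word_cong :: "(nat sword \<times> nat sword) set" where
  "word_cong \<equiv> pres_cong {1..n} (map_prod pos_word pos_word ` G_rels d n)"

abbreviation words :: "nat list set" where
  "words \<equiv> lists {1..n}"

lemma pos_word_simps [simp]:
  "pos_word [] = []" "pos_word (a # u) = (a, True) # pos_word u"
  by (simp_all add: pos_word_def)

lemma pos_word_swords: "u \<in> lists S \<Longrightarrow> pos_word u \<in> swords S"
  by (auto simp: pos_word_def swords_def)

lemma val_eq_class: "u \<in> words \<Longrightarrow> val u = word_cong `` {pos_word u}"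
proof (induction u)
  case Nil
  show ?case by (simp add: word_value_def G_group_def presented_group_def)
next
  case (Cons a u)
  have "val (a # u) = word_cong `` {pos_word [a]} \<otimes>\<^bsub>G_group d n\<^esub> word_cong `` {pos_word u}"
    using Cons by (simp add: word_value_def G_gen_def)
  also have "\<dots> = word_cong `` {pos_word [a] @ pos_word u}"
    unfolding G_group_def using Cons.prems
    by (intro presented_group_mult pos_word_swords) auto
  also have "pos_word [a] @ pos_word u = pos_word (a # u)"
    by simp
  finally show ?case .
qed

lemma val_closed: "u \<in> words \<Longrightarrow> val u \<in> carrier (G_group d n)"
  by (auto simp: val_eq_class G_group_def presented_group_def intro!: quotientI pos_word_swords)

lemma val_Nil: "val [] = \<one>\<^bsub>G_group d n\<^esub>"
  by (simp add: word_value_def)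

lemma val_append:
  "u \<in> words \<Longrightarrow> v \<in> words \<Longrightarrow> val (u @ v) = val u \<otimes>\<^bsub>G_group d n\<^esub> val v"
  unfolding val_eq_class G_group_def
  by (simp add: val_eq_class presented_group_mult pos_word_swords)
     (simp add: pos_word_def)

lemma val_eq_iff:
  assumes "u \<in> words" "v \<in> words"
  shows "val u = val v \<longleftrightarrow> (pos_word u, pos_word v) \<in> word_cong"
  unfolding val_eq_class[OF assms(1)] val_eq_class[OF assms(2)]
  by (intro eq_equiv_class_iff[OF equiv_pres_cong] pos_word_swords assms)

lemma G_rels_words: "(l, r) \<in> G_rels d n \<Longrightarrow> l \<in> words \<and> r \<in> words"
  using n_pos by (auto simp: G_rels_def split: if_splits)

lemma val_rel: "(l, r) \<in> G_rels d n \<Longrightarrow> val l = val r"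
  using G_rels_words[of l r]
  by (subst val_eq_iff) (auto intro!: pres_cong.rel pos_word_swords)

lemma val_subword:
  assumes "val l = val r" "l \<in> words" "r \<in> words" "x \<in> words" "y \<in> words"
  shows "val (x @ l @ y) = val (x @ r @ y)"
  using assms by (simp add: val_append)

text \<open>
  This says that \<open>s\<^sub>n\<close> commutes with \<open>s\<^sub>n\<^sub>-\<^sub>1 s\<^sub>n\<^sup>k s\<^sub>n\<^sub>-\<^sub>1\<close>. The
  defining relation is the case \<open>k = 1\<close>, and
  \<open>s\<^sub>n\<^sub>-\<^sub>1 s\<^sub>n\<^sup>k s\<^sub>n\<^sub>-\<^sub>1\<close> is the \<open>k\<close>-th power of
  \<open>s\<^sub>n\<^sub>-\<^sub>1 s\<^sub>n s\<^sub>n\<^sub>-\<^sub>1\<close>.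
\<close>

lemma val_crossing:
  assumes "2 \<le> n"
  shows "val ([n, n - 1] @ replicate k n @ [n - 1]) = val ([n - 1] @ replicate k n @ [n - 1, n])"
proof (induction k)
  have W: "n \<in> {1..n}" "n - 1 \<in> {1..n}" "replicate k n \<in> words" for k
    using assms by (auto simp: in_lists_conv_set)
  have sq: "val [n - 1, n - 1] = val []"
    by (rule val_rel) (use assms in \<open>auto simp: G_rels_def\<close>)
  have br: "val [n, n - 1, n, n - 1] = val [n - 1, n, n - 1, n]"
    by (rule val_rel) (use assms in \<open>auto simp: G_rels_def\<close>)
  {
    case 0
    show ?case
      using val_subword[OF sq, of "[n]" "[]"] val_subword[OF sq, of "[]" "[n]"] W by simp
  next
    case (Suc k)
    let ?R = "replicate k n"
    \<comment> \<open>Inserting \<open>s\<^sub>n\<^sub>-\<^sub>1 s\<^sub>n\<^sub>-\<^sub>1\<close> splits off one factor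
      \<open>s\<^sub>n\<^sub>-\<^sub>1 s\<^sub>n s\<^sub>n\<^sub>-\<^sub>1\<close>, so that the induction hypothesis applies.\<close>
    have "val ([n, n - 1] @ replicate (Suc k) n @ [n - 1]) = val ([n, n - 1] @ ?R @ [n, n - 1])"
      by (simp add: replicate_app_Cons_same)
    also have "\<dots> = val ([n, n - 1] @ ?R @ [n - 1, n - 1] @ [n, n - 1])"
      using val_subword[OF sq, of "[n, n - 1] @ ?R" "[n, n - 1]"] W by simp
    also have "\<dots> = val ([n - 1] @ ?R @ [n - 1, n] @ [n - 1, n, n - 1])"
      using val_subword[OF Suc.IH, of "[]" "[n - 1, n, n - 1]"] W by simp
    also have "\<dots> = val ([n - 1] @ ?R @ [n - 1] @ [n - 1, n, n - 1, n])"
      using val_subword[OF br, of "[n - 1] @ ?R @ [n - 1]" "[]"] W by simp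
    also have "\<dots> = val ([n - 1] @ ?R @ [n, n - 1, n])"
      using val_subword[OF sq, of "[n - 1] @ ?R" "[n, n - 1, n]"] W by simp
    also have "\<dots> = val ([n - 1] @ replicate (Suc k) n @ [n - 1, n])"
      by (simp add: replicate_app_Cons_same)
    finally show ?case .
  }
qed

text \<open>
  Inverse letters can be avoided, because every generator has finite order:
  \<open>s\<^sub>i\<close> is its own inverse for \<open>i < n\<close>, and \<open>s\<^sub>n\<^sup>d\<^sup>-\<^sup>1\<close> is the inverse of
  \<open>s\<^sub>n\<close>.
\<close>

lemma val_onto:
  assumes "w \<in> carrier (G_group d n)"
  shows "\<exists>u\<in>words. val u = w"
proof -
  have mult: "word_cong `` {u @ v} = word_cong `` {u} \<otimes>\<^bsub>G_group d n\<^esub> word_cong `` {v}"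
    if "u \<in> swords {1..n}" "v \<in> swords {1..n}" for u v
    using that by (simp add: G_group_def presented_group_mult)
  have letter: "\<exists>v\<in>words. val v = word_cong `` {[(a, b)]}" if a: "a \<in> {1..n}" for a b
  proof (cases b)
    case True
    then show ?thesis
      using a val_eq_class[of "[a]"] by (intro bexI[of _ "[a]"]) auto
  next
    case False
    define v where "v = (if a < n then [a] else replicate (d - 1) n)"
    have v: "v \<in> words" using a n_pos by (auto simp: v_def)
    have "val (v @ [a]) = val []"
    proof (rule val_rel)
      have "v @ [a] = (if a < n then [a, a] else replicate d n)"
        using a d_pos by (cases d) (auto simp: v_def replicate_append_same)
      then show "(v @ [a], []) \<in> G_rels d n"
        using a by (auto simp: G_rels_def)
    qed
    then have 1: "val v \<otimes>\<^bsub>G_group d n\<^esub> val [a] = \<one>\<^bsub>G_group d n\<^esub>"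
      using v a by (simp add: val_append val_Nil)
    have aF: "[(a, False)] \<in> swords {1..n}" "[(a, True)] \<in> swords {1..n}"
      using a by (auto simp: swords_def)
    have "word_cong `` {[(a, False)] @ [(a, True)]} = word_cong `` {[]}"
      using pres_cong.cancel[OF a, of False]
      by (intro equiv_class_eq[OF equiv_pres_cong]) simp
    then have "word_cong `` {[(a, False)]} \<otimes>\<^bsub>G_group d n\<^esub> val [a] = \<one>\<^bsub>G_group d n\<^esub>"
      using mult[OF aF] a val_eq_class[of "[a]"] val_eq_class[of "[]"]
      by (simp add: val_Nil)
    moreover have "word_cong `` {[(a, False)]} \<in> carrier (G_group d n)"
      using aF by (auto simp: G_group_def presented_group_def intro: quotientI)
    ultimately have "val v = word_cong `` {[(a, False)]}"
      using 1 v a by (metis G.right_cancel val_closed Cons_in_lists_iff lists.Nil)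
    then show ?thesis using v False by auto
  qed
  obtain u where u: "u \<in> swords {1..n}" "w = word_cong `` {u}"
    using assms by (auto simp: G_group_def presented_group_def elim: quotientE)
  have "\<exists>v\<in>words. val v = word_cong `` {u}"
    using u(1)
  proof (induction u)
    case Nil
    then show ?case using val_eq_class[of "[]"] by (intro bexI[of _ "[]"]) auto
  next
    case (Cons x u)
    obtain a b where x: "x = (a, b)" by force
    have a: "a \<in> {1..n}" and u: "u \<in> swords {1..n}"
      using Cons.prems by (auto simp: swords_def x)
    obtain v v' where v: "v \<in> words" "val v = word_cong `` {[(a, b)]}"
      "v' \<in> words" "val v' = word_cong `` {u}"
      using letter[OF a] Cons.IH[OF u] by blast
    have "val (v @ v') = word_cong `` {[(a, b)] @ u}"
      using v u a by (subst mult) (auto simp: val_append swords_def)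
    then show ?case using v by (intro bexI[of _ "v @ v'"]) (auto simp: x)
  qed
  then show ?thesis using u by simp
qed

section \<open>Rewriting that does not lengthen words\<close>

text \<open>
  This relation records what matters about a sequence of moves: if a deletion was among them, the word
  has become strictly shorter, and otherwise both ends are \<open>\<approx>\<close>-equivalent. It is transitive because
  \<open>\<approx>\<close> preserves length.
\<close>

definition reduces :: "nat list \<Rightarrow> nat list \<Rightarrow> bool" (infix "\<leadsto>" 50) where
  "u \<leadsto> v \<longleftrightarrow> u \<in> words \<and> v \<in> words \<and> val u = val v \<and>
     ((u, v) \<in> braid_equiv d n \<or> length v < length u)"

lemma braid_equiv_length: "(u, v) \<in> braid_equiv d n \<Longrightarrow> length u = length v"
proof -
  have "length u = length v" if "(u, v) \<in> (braid_step d n \<union> (braid_step d n)\<inverse>)\<^sup>*" for u v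
    using that by induction (auto simp: braid_step_def braid_rels_def)
  then show "(u, v) \<in> braid_equiv d n \<Longrightarrow> length u = length v"
    by (auto simp: braid_equiv_def)
qed

lemma braid_equiv_subword:
  assumes "(u, v) \<in> braid_equiv d n" "x \<in> words" "y \<in> words"
  shows "(x @ u @ y, x @ v @ y) \<in> braid_equiv d n"
proof -
  let ?s = "braid_step d n \<union> (braid_step d n)\<inverse>"
  have move: "(x @ a @ y, x @ b @ y) \<in> braid_step d n" if "(a, b) \<in> braid_step d n" for a b
  proof -
    obtain p l r q where "a = p @ l @ q" "b = p @ r @ q" "p \<in> words" "q \<in> words"
      "(l, r) \<in> braid_rels d n"
      using \<open>(a, b) \<in> braid_step d n\<close> by (auto simp: braid_step_def)
    then have "x @ a @ y = (x @ p) @ l @ (q @ y)" "x @ b @ y = (x @ p) @ r @ (q @ y)"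
      "x @ p \<in> words" "q @ y \<in> words" "(l, r) \<in> braid_rels d n"
      using assms by simp_all
    then show ?thesis unfolding braid_step_def by blast
  qed
  have "(u, v) \<in> ?s\<^sup>*" using assms by (auto simp: braid_equiv_def)
  then have "(x @ u @ y, x @ v @ y) \<in> ?s\<^sup>*"
  proof induction
    case (step b c)
    then have "(x @ b @ y, x @ c @ y) \<in> ?s" using move by blast
    with step show ?case by (meson rtrancl.rtrancl_into_rtrancl)
  qed simp
  then show ?thesis using assms by (auto simp: braid_equiv_def)
qed

lemma reduces_refl: "u \<in> words \<Longrightarrow> u \<leadsto> u"
  by (auto simp: reduces_def braid_equiv_def)

lemma reduces_trans [trans]:
  assumes "u \<leadsto> v" "v \<leadsto> x" shows "u \<leadsto> x"
proof -
  have "(u, x) \<in> braid_equiv d n" if "(u, v) \<in> braid_equiv d n" "(v, x) \<in> braid_equiv d n"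
    using equiv_braid_equiv that by (meson equivE transD)
  then show ?thesis
    using assms braid_equiv_length[of u v] braid_equiv_length[of v x]
    by (auto simp: reduces_def)
qed

lemma reduces_subword:
  "u \<leadsto> v \<Longrightarrow> x \<in> words \<Longrightarrow> y \<in> words \<Longrightarrow> x @ u @ y \<leadsto> x @ v @ y"
  unfolding reduces_def using val_subword[of u v x y] braid_equiv_subword[of u v x y] by auto

lemma reduces_braid_rel:
  assumes "(l, r) \<in> braid_rels d n" "val l = val r" "l \<in> words" "r \<in> words"
  shows "l \<leadsto> r" "r \<leadsto> l"
proof -
  have "(l, r) \<in> braid_step d n"
    using assms unfolding braid_step_def
    by (intro CollectI exI[of _ "[]"] exI[of _ l] exI[of _ r] exI[of _ "[]"]) auto
  then show "l \<leadsto> r" "r \<leadsto> l"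
    using assms by (auto simp: reduces_def braid_equiv_def)
qed

lemma reduces_commute:
  assumes "i \<in> {1..n}" "j \<in> {1..n}" "i + 1 < j \<or> j + 1 < i"
  shows "[i, j] \<leadsto> [j, i]"
proof -
  have *: "[i, j] \<leadsto> [j, i] \<and> [j, i] \<leadsto> [i, j]"
    if "i \<in> {1..n}" "j \<in> {1..n}" "j + 1 < i" for i j
    using that by (intro conjI reduces_braid_rel val_rel[symmetric] val_rel)
      (auto simp: G_rels_def braid_rels_def)
  show ?thesis using assms *[of i j] *[of j i] by blast
qed

lemma reduces_braid:
  assumes "1 \<le> i" "i + 2 \<le> n"
  shows "[i + 1, i, i + 1] \<leadsto> [i, i + 1, i]" "[i, i + 1, i] \<leadsto> [i + 1, i, i + 1]"
  using assms by (intro reduces_braid_rel val_rel; auto simp: G_rels_def braid_rels_def)+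

lemma reduces_crossing:
  assumes "2 \<le> n" "1 \<le> k" "k < d"
  shows "[n - 1] @ replicate k n @ [n - 1, n] \<leadsto> [n, n - 1] @ replicate k n @ [n - 1]"
proof (rule reduces_braid_rel(2))
  have "([n, n - 1] @ replicate k n @ [n - 1], [n - 1] @ replicate k n @ [n - 1, n]) =
    (replicate 1 n @ [n - 1] @ replicate k n @ [n - 1],
     [n - 1] @ replicate k n @ [n - 1] @ replicate 1 n)" by simp
  moreover have "1 < d" using assms by simp
  ultimately show "([n, n - 1] @ replicate k n @ [n - 1], [n - 1] @ replicate k n @ [n - 1, n])
    \<in> braid_rels d n"
    using assms unfolding braid_rels_def by blast
qed (use assms val_crossing in auto)

lemma reduces_delete:
  assumes "1 \<le> i" "i < n" shows "[i, i] \<leadsto> []"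
proof -
  have "val [i, i] = val []" by (rule val_rel) (use assms in \<open>auto simp: G_rels_def\<close>)
  then show ?thesis using assms by (simp add: reduces_def)
qed

lemma reduces_delete_power: "replicate d n \<leadsto> []"
proof -
  have "val (replicate d n) = val []" by (rule val_rel) (simp add: G_rels_def)
  then show ?thesis using d_pos n_pos by (simp add: reduces_def in_lists_conv_set)
qed

lemma reduces_pass_left:
  assumes "xs \<in> words" "s \<in> {1..n}" "\<And>x. x \<in> set xs \<Longrightarrow> x + 1 < s \<or> s + 1 < x"
  shows "xs @ [s] \<leadsto> s # xs"
  using assms
proof (induction xs)
  case Nil
  then show ?case by (simp add: reduces_refl)
next
  case (Cons x xs)
  have "[x] @ (xs @ [s]) @ [] \<leadsto> [x] @ (s # xs) @ []"
    using Cons by (intro reduces_subword) auto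
  also have "[x] @ (s # xs) @ [] = [] @ [x, s] @ xs" by simp
  also have "\<dots> \<leadsto> [] @ [s, x] @ xs"
    using Cons by (intro reduces_subword reduces_commute) auto
  finally show ?case by simp
qed

lemma upt_words: "1 \<le> m \<Longrightarrow> i \<le> n + 1 \<Longrightarrow> [m..<i] \<in> words"
  by auto

text \<open>
  A letter \<open>j\<close> travelling left through \<open>m, \<dots>, i - 1\<close> meets the block \<open>j, j + 1\<close>. There the
  braid relation turns it into \<open>j + 1\<close>, and this letter commutes with all that remains.
\<close>

lemma reduces_ascending:
  assumes "1 \<le> m" "m \<le> j" "j + 1 < i" "i \<le> n"
  shows "[m..<i] @ [j] \<leadsto> (j + 1) # [m..<i]"
proof -
  have cut: "[m..<i] = [m..<j] @ [j, j + 1] @ [j + 2..<i]"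
  proof -
    have "[m..<i] = [m..<j] @ [j..<i]" using assms upt_add_eq_append[of m j "i - j"] by simp
    then show ?thesis using assms by (simp add: upt_conv_Cons)
  qed
  have "([m..<j] @ [j, j + 1]) @ ([j + 2..<i] @ [j]) @ [] \<leadsto>
        ([m..<j] @ [j, j + 1]) @ (j # [j + 2..<i]) @ []"
    using assms by (intro reduces_subword reduces_pass_left) auto
  also have "\<dots> = [m..<j] @ [j, j + 1, j] @ [j + 2..<i]" by simp
  also have "\<dots> \<leadsto> [m..<j] @ [j + 1, j, j + 1] @ [j + 2..<i]"
    using assms by (intro reduces_subword reduces_braid) auto
  also have "\<dots> = [] @ ([m..<j] @ [j + 1]) @ ([j, j + 1] @ [j + 2..<i])" by simp
  also have "\<dots> \<leadsto> [] @ ((j + 1) # [m..<j]) @ ([j, j + 1] @ [j + 2..<i])"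
    using assms by (intro reduces_subword reduces_pass_left) auto
  finally show ?thesis by (simp add: cut)
qed

text \<open>The mirror image: through a descending run, a travelling letter is lowered by one.\<close>

lemma reduces_descending:
  assumes "1 \<le> j" "j \<le> q" "q + 1 < n"
  shows "rev [j..<n] @ [q + 1] \<leadsto> q # rev [j..<n]"
proof -
  have cut: "rev [j..<n] = rev [q + 2..<n] @ [q + 1, q] @ rev [j..<q]"
  proof -
    have "[j..<n] = [j..<q] @ [q..<n]" using assms upt_add_eq_append[of j q "n - q"] by simp
    then show ?thesis using assms by (simp add: upt_conv_Cons)
  qed
  have "(rev [q + 2..<n] @ [q + 1, q]) @ (rev [j..<q] @ [q + 1]) @ [] \<leadsto>
        (rev [q + 2..<n] @ [q + 1, q]) @ ((q + 1) # rev [j..<q]) @ []"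
    using assms by (intro reduces_subword reduces_pass_left) auto
  also have "\<dots> = rev [q + 2..<n] @ [q + 1, q, q + 1] @ rev [j..<q]" by simp
  also have "\<dots> \<leadsto> rev [q + 2..<n] @ [q, q + 1, q] @ rev [j..<q]"
    using assms by (intro reduces_subword reduces_braid) auto
  also have "\<dots> = [] @ (rev [q + 2..<n] @ [q]) @ ([q + 1, q] @ rev [j..<q])" by simp
  also have "\<dots> \<leadsto> [] @ (q # rev [q + 2..<n]) @ ([q + 1, q] @ rev [j..<q])"
    using assms by (intro reduces_subword reduces_pass_left) auto
  finally show ?thesis by (simp add: cut)
qed

section \<open>Existence of normal forms\<close>

text \<open>
  The indices \<open>(j, k)\<close> are the point to which the representative moves \<open>(m, 0)\<close> in the
  action defined further below.
\<close>

definition coset_rep :: "nat \<Rightarrow> nat \<Rightarrow> nat \<Rightarrow> nat list" where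
  "coset_rep m j k =
     (if k = 0 then [m..<j] else [m..<n] @ replicate k n @ rev [j..<n])"

inductive normal :: "nat \<Rightarrow> nat list \<Rightarrow> bool" where
  empty: "normal (n + 1) []"
| extend: "normal (Suc m) a \<Longrightarrow> 1 \<le> m \<Longrightarrow> m \<le> j \<Longrightarrow> j \<le> n \<Longrightarrow> k < d \<Longrightarrow>
    normal m (a @ coset_rep m j k)"

lemma set_coset_rep: "j \<le> n \<Longrightarrow> m \<le> j \<Longrightarrow> set (coset_rep m j k) \<subseteq> {m..n}"
  by (auto simp: coset_rep_def)

lemma normal_letters: "normal m a \<Longrightarrow> 1 \<le> m \<and> set a \<subseteq> {m..n}"
proof (induction rule: normal.induct)
  case (extend m a j k)
  then show ?case using set_coset_rep[of j m k] by force
qed simp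

lemma coset_rep_words: "1 \<le> m \<Longrightarrow> m \<le> j \<Longrightarrow> j \<le> n \<Longrightarrow> coset_rep m j k \<in> words"
  using set_coset_rep[of j m k] by (auto simp: in_lists_conv_set)

text \<open>
  Representatives without the letter \<open>s\<^sub>n\<close>. Only the letters \<open>j\<close> and \<open>j - 1\<close> next to the end
  of the run change the coset: they prolong or shorten the run. Prolonging by \<open>s\<^sub>n\<close> leads to the other
  kind of representative, so that case is excluded here.
\<close>

lemma coset_rep_step_ascending:
  assumes "1 \<le> m" "m \<le> j" "j \<le> n" "s \<in> {m..n}" "s \<noteq> n \<or> j \<noteq> n"
  shows "(\<exists>j'. m \<le> j' \<and> j' \<le> n \<and> [m..<j] @ [s] \<leadsto> [m..<j']) \<or>
    (\<exists>t\<in>{m+1..n}. [m..<j] @ [s] \<leadsto> t # [m..<j])"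
proof -
  consider "s = j" "j < n" | "j = s + 1" | "s > j" | "s + 1 < j"
    using assms by fastforce
  then show ?thesis
  proof cases
    case 1
    then have "[m..<j] @ [s] \<leadsto> [m..<j + 1]"
      using assms reduces_refl[OF upt_words[of m "j + 1"]] by simp
    then show ?thesis using 1 assms by (intro disjI1 exI[of _ "j + 1"]) auto
  next
    case 2
    have "[m..<s] @ [s, s] @ [] \<leadsto> [m..<s] @ [] @ []"
      using 2 assms by (intro reduces_subword reduces_delete) auto
    then have "[m..<j] @ [s] \<leadsto> [m..<s]" using 2 assms by simp
    then show ?thesis using 2 assms by (intro disjI1 exI[of _ s]) auto
  next
    case 3
    then have "[m..<j] @ [s] \<leadsto> s # [m..<j]"
      using assms by (intro reduces_pass_left upt_words) auto
    then show ?thesis using 3 assms by (intro disjI2 bexI[of _ s]) auto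
  next
    case 4
    then have "[m..<j] @ [s] \<leadsto> (s + 1) # [m..<j]"
      using assms by (intro reduces_ascending) auto
    then show ?thesis using 4 assms by (intro disjI2 bexI[of _ "s + 1"]) auto
  qed
qed

text \<open>
  Representatives that run up to \<open>s\<^sub>n\<^sup>k\<close> and down again. A letter \<open>s > j\<close> other than
  \<open>s\<^sub>n\<close> is lowered by the descending run and raised again by the ascending one, so it comes out
  unchanged. The letter \<open>s\<^sub>n\<close> crosses \<open>s\<^sub>n\<^sub>-\<^sub>1 s\<^sub>n\<^sup>k s\<^sub>n\<^sub>-\<^sub>1\<close>; this is the only
  place where the relation between \<open>s\<^sub>n\<^sub>-\<^sub>1\<close> and \<open>s\<^sub>n\<close> enters.
\<close>

lemma coset_rep_step_turned:
  assumes "1 \<le> m" "m \<le> j" "j \<le> n" "s \<in> {m..n}" "s \<noteq> n \<or> j \<noteq> n" "1 \<le> k" "k < d"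
  defines "r \<equiv> \<lambda>j. [m..<n] @ replicate k n @ rev [j..<n]"
  shows "(\<exists>j'. m \<le> j' \<and> j' \<le> n \<and> r j @ [s] \<leadsto> r j') \<or>
    (\<exists>t\<in>{m+1..n}. r j @ [s] \<leadsto> t # r j)"
proof -
  have rw: "r j' \<in> words" if "m \<le> j'" for j'
    using that assms by (auto simp: r_def)
  consider "j = s + 1" | "s = j" "j < n" | "s + 1 < j" | "j < s" "s < n" | "s = n" "j < n"
    using assms by fastforce
  then show ?thesis
  proof cases
    case 1
    then have "r j @ [s] \<leadsto> r s"
      using assms reduces_refl[OF rw[of s]] by (simp add: r_def upt_conv_Cons)
    then show ?thesis using 1 assms by (intro disjI1 exI[of _ s]) auto
  next
    case 2
    have "r (j + 1) @ [s, s] @ [] \<leadsto> r (j + 1) @ [] @ []"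
      using 2 assms rw by (intro reduces_subword reduces_delete) auto
    then have "r j @ [s] \<leadsto> r (j + 1)" using 2 by (simp add: r_def upt_conv_Cons)
    then show ?thesis using 2 assms by (intro disjI1 exI[of _ "j + 1"]) auto
  next
    case 3
    have "[m..<n] @ ((replicate k n @ rev [j..<n]) @ [s]) @ []
      \<leadsto> [m..<n] @ (s # (replicate k n @ rev [j..<n])) @ []"
      using 3 assms by (intro reduces_subword reduces_pass_left) auto
    also have "\<dots> = [] @ ([m..<n] @ [s]) @ (replicate k n @ rev [j..<n])" by simp
    also have "\<dots> \<leadsto> [] @ ((s + 1) # [m..<n]) @ (replicate k n @ rev [j..<n])"
      using 3 assms by (intro reduces_subword reduces_ascending) auto
    finally have "r j @ [s] \<leadsto> (s + 1) # r j" by (simp add: r_def)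
    then show ?thesis using 3 assms by (intro disjI2 bexI[of _ "s + 1"]) auto
  next
    case 4
    then obtain q where q: "s = q + 1" "j \<le> q" by (metis Suc_eq_plus1 less_imp_Suc_add le_add1)
    have "([m..<n] @ replicate k n) @ (rev [j..<n] @ [q + 1]) @ []
      \<leadsto> ([m..<n] @ replicate k n) @ (q # rev [j..<n]) @ []"
      using 4 q assms by (intro reduces_subword reduces_descending) auto
    also have "\<dots> = [m..<n] @ (replicate k n @ [q]) @ rev [j..<n]" by simp
    also have "\<dots> \<leadsto> [m..<n] @ (q # replicate k n) @ rev [j..<n]"
      using 4 q assms by (intro reduces_subword reduces_pass_left) auto
    also have "\<dots> = [] @ ([m..<n] @ [q]) @ (replicate k n @ rev [j..<n])" by simp
    also have "\<dots> \<leadsto> [] @ ((q + 1) # [m..<n]) @ (replicate k n @ rev [j..<n])"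
      using 4 q assms by (intro reduces_subword reduces_ascending) auto
    finally have "r j @ [s] \<leadsto> s # r j" by (simp add: r_def q)
    then show ?thesis using 4 assms by (intro disjI2 bexI[of _ s]) auto
  next
    case 5
    have n: "2 \<le> n" using 5 assms by simp
    obtain p where p: "n = Suc p" using n_pos by (cases n) auto
    have up: "[m..<n] = [m..<n - 1] @ [n - 1]" and down: "rev [j..<n] = [n - 1] @ rev [j..<n - 1]"
      using 5 assms p by simp_all
    have "([m..<n] @ replicate k n @ [n - 1]) @ (rev [j..<n - 1] @ [n]) @ []
      \<leadsto> ([m..<n] @ replicate k n @ [n - 1]) @ (n # rev [j..<n - 1]) @ []"
      using 5 n assms by (intro reduces_subword reduces_pass_left) auto
    also have "\<dots> = [m..<n - 1] @ ([n - 1] @ replicate k n @ [n - 1, n]) @ rev [j..<n - 1]"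
      by (simp add: up)
    also have "\<dots> \<leadsto> [m..<n - 1] @ ([n, n - 1] @ replicate k n @ [n - 1]) @ rev [j..<n - 1]"
      using n assms by (intro reduces_subword reduces_crossing) auto
    also have "\<dots> = [] @ ([m..<n - 1] @ [n]) @ ([n - 1] @ replicate k n @ [n - 1] @ rev [j..<n - 1])"
      by simp
    also have "\<dots> \<leadsto> [] @ (n # [m..<n - 1]) @ ([n - 1] @ replicate k n @ [n - 1] @ rev [j..<n - 1])"
      using n assms by (intro reduces_subword reduces_pass_left) auto
    finally have "r j @ [s] \<leadsto> n # r j" using 5 by (simp add: r_def up down)
    then show ?thesis using 5 assms by (intro disjI2 bexI[of _ n]) auto
  qed
qed

text \<open>
  Multiplying \<open>r\<close> by \<open>s\<close> either moves to another coset or replaces \<open>r s\<close> by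
  \<open>t r\<close> with \<open>t\<close> a generator of \<open>W\<^sub>m\<^sub>+\<^sub>1\<close>. What the two preceding lemmas leave open is a power of
  \<open>s\<^sub>n\<close> at the end growing by one; for \<open>d = 1\<close> it is deleted at once.
\<close>

lemma coset_rep_step:
  assumes "1 \<le> m" "m \<le> j" "j \<le> n" "k < d" "s \<in> {m..n}"
  shows "(\<exists>j' k'. m \<le> j' \<and> j' \<le> n \<and> k' < d \<and> coset_rep m j k @ [s] \<leadsto> coset_rep m j' k') \<or>
    (\<exists>t\<in>{m+1..n}. coset_rep m j k @ [s] \<leadsto> t # coset_rep m j k)"
proof (cases "s = n \<and> j = n")
  case True
  have power: "coset_rep m n k = [m..<n] @ replicate k n" for k
    by (simp add: coset_rep_def)
  have "\<exists>k'<d. coset_rep m n k @ [n] \<leadsto> coset_rep m n k'"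
  proof (cases "k + 1 < d")
    case True
    then have "coset_rep m n k @ [n] \<leadsto> coset_rep m n (k + 1)"
      using assms reduces_refl[OF coset_rep_words[of m n "k + 1"]]
      by (simp add: power replicate_append_same)
    then show ?thesis using True by blast
  next
    case False
    then have "k + 1 = d" using assms by simp
    then have "coset_rep m n k @ [n] = [m..<n] @ replicate d n @ []"
      by (auto simp: power replicate_append_same)
    also have "\<dots> \<leadsto> [m..<n] @ [] @ []"
      using assms by (intro reduces_subword reduces_delete_power) auto
    finally have "coset_rep m n k @ [n] \<leadsto> coset_rep m n 0" by (simp add: power)
    then show ?thesis using d_pos by (intro exI[of _ 0]) auto
  qed
  then show ?thesis using True assms by blast
next
  case False
  show ?thesis
  proof (cases "k = 0")
    case True
    then show ?thesis
      using coset_rep_step_ascending[of m j s] False assms d_pos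
      by (auto simp: coset_rep_def)
  next
    case k: False
    then have "coset_rep m j' k = [m..<n] @ replicate k n @ rev [j'..<n]" for j'
      by (simp add: coset_rep_def)
    then show ?thesis
      using coset_rep_step_turned[of m j s k] False k assms
      by (metis (no_types, lifting) One_nat_def Suc_leI neq0_conv)
  qed
qed

lemma normal_snoc:
  assumes "normal m a" "s \<in> {m..n}"
  shows "\<exists>b. normal m b \<and> a @ [s] \<leadsto> b"
  using assms
proof (induction arbitrary: s rule: normal.induct)
  case (extend m a j k)
  have aw: "a \<in> words" using normal_letters[OF extend.hyps(1)] by auto
  have rw: "coset_rep m j k \<in> words" using extend by (intro coset_rep_words)
  from coset_rep_step[OF extend.hyps(2-5) extend.prems] show ?case
  proof (elim disjE exE conjE bexE)
    fix j' k' assume *: "m \<le> j'" "j' \<le> n" "k' < d" "coset_rep m j k @ [s] \<leadsto> coset_rep m j' k'"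
    then have "a @ (coset_rep m j k @ [s]) @ [] \<leadsto> a @ coset_rep m j' k' @ []"
      using aw by (intro reduces_subword) auto
    then show ?thesis using * extend.hyps by (auto intro!: normal.extend exI[of _ "a @ coset_rep m j' k'"])
  next
    fix t assume t: "t \<in> {m+1..n}" "coset_rep m j k @ [s] \<leadsto> t # coset_rep m j k"
    obtain b where b: "normal (Suc m) b" "a @ [t] \<leadsto> b" using extend.IH[of t] t by auto
    have "a @ (coset_rep m j k @ [s]) @ [] \<leadsto> a @ (t # coset_rep m j k) @ []"
      using t aw by (intro reduces_subword) auto
    also have "\<dots> = [] @ (a @ [t]) @ coset_rep m j k" by simp
    also have "\<dots> \<leadsto> [] @ b @ coset_rep m j k"
      using b rw by (intro reduces_subword) auto
    finally show ?thesis
      using b extend.hyps by (auto intro!: normal.extend exI[of _ "b @ coset_rep m j k"])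
  qed
qed simp

lemma normal_Nil: "1 \<le> m \<Longrightarrow> m \<le> n + 1 \<Longrightarrow> normal m []"
proof (induction "n + 1 - m" arbitrary: m)
  case 0
  then show ?case using normal.empty by (simp add: le_antisym)
next
  case (Suc x)
  then have "normal (Suc m) []" by simp
  from normal.extend[OF this, of m 0] Suc d_pos show ?case by (simp add: coset_rep_def)
qed

lemma reduces_to_normal: "u \<in> words \<Longrightarrow> \<exists>a. normal 1 a \<and> u \<leadsto> a"
proof (induction u rule: rev_induct)
  case Nil
  then show ?case using normal_Nil reduces_refl by auto
next
  case (snoc s u)
  then obtain a where a: "normal 1 a" "u \<leadsto> a" by auto
  obtain b where b: "normal 1 b" "a @ [s] \<leadsto> b" using normal_snoc[OF a(1), of s] snoc by auto
  have "[] @ u @ [s] \<leadsto> [] @ a @ [s]" using a snoc by (intro reduces_subword) auto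
  with b show ?case by (auto intro: reduces_trans)
qed

section \<open>Uniqueness of normal forms\<close>

text \<open>
  Words act from the right, through \<open>fold\<close>. The letter \<open>s\<^sub>n\<close> leaves every
  colour \<open>c \<ge> d\<close> in place instead of reducing it modulo \<open>d\<close>, so that every generator is a bijection of the whole type and no
  carrier set has to be tracked.
\<close>

definition act :: "nat \<Rightarrow> nat \<times> nat \<Rightarrow> nat \<times> nat" where
  "act i = (\<lambda>(p, c). if i < n then (transpose i (i + 1) p, c)
     else if p = n \<and> c < d then (n, (c + 1) mod d) else (p, c))"

lemma act_power:
  "(act n ^^ k) (p, c) = (if p = n \<and> c < d then (n, (c + k) mod d) else (p, c))"
proof (induction k)
  case (Suc k)
  then show ?case using d_pos by (auto simp: act_def mod_simps)
qed auto

lemma act_rel: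
  assumes "(l, r) \<in> G_rels d n" shows "fold act l = fold act r"
proof (rule ext)
  fix x :: "nat \<times> nat"
  obtain p c where x: "x = (p, c)" by force
  show "fold act l x = fold act r x"
  proof -
    from assms consider
      (power) "l = replicate d n" "r = []"
      | (square) i where "l = [i, i]" "r = []" "i < n"
      | (commute) i j where "l = [i, j]" "r = [j, i]" "j + 1 < i" "i \<le> n"
      | (braid) i where "l = [i + 1, i, i + 1]" "r = [i, i + 1, i]" "i + 1 < n"
      | (crossing) "l = [n, n - 1, n, n - 1]" "r = [n - 1, n, n - 1, n]"
      using n_pos unfolding G_rels_def by (fastforce split: if_splits)
    then show ?thesis
    proof cases
      case power
      then show ?thesis by (simp add: x act_power)
    next
      case square
      then show ?thesis by (simp add: x act_def)
    next
      case commute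
      then consider "p = j" | "p = j + 1" | "p = i" | "p = i + 1" | "p \<notin> {i, i + 1, j, j + 1}"
        by blast
      then show ?thesis
        using commute by cases (auto simp: x act_def transpose_def)
    next
      case braid
      then consider "p = i" | "p = i + 1" | "p = i + 2" | "p \<notin> {i, i + 1, i + 2}" by blast
      then show ?thesis
        using braid by cases (simp_all add: x act_def transpose_def)
    next
      case crossing
      \<comment> \<open>Rewriting towards \<open>n\<close> and \<open>q\<close> keeps \<open>n\<close>, a parameter of \<open>act\<close>, in place.\<close>
      define q where "q = n - 1"
      have q: "n - Suc 0 = q" "Suc q = n" "q < n" using n_pos by (auto simp: q_def)
      consider "p = n" | "p = q" | "p \<noteq> n" "p \<noteq> q" by blast
      then show ?thesis
        using crossing by cases (simp_all add: x q act_def transpose_def)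
    qed
  qed
qed

lemma bij_act: "i \<in> {1..n} \<Longrightarrow> bij (act i)"
proof -
  assume i: "i \<in> {1..n}"
  define v where "v = (if i < n then [i] else replicate (d - 1) n)"
  have "(v @ [i], []) \<in> G_rels d n" "v @ [i] = i # v"
    using i d_pos by (cases d; auto simp: v_def G_rels_def replicate_append_same)+
  then have "fold act (v @ [i]) = id" "fold act (i # v) = id"
    using act_rel by (metis fold_simps(1) eq_id_iff)+
  then show ?thesis by (intro o_bij[of "fold act v"]) auto
qed

definition signed_act :: "nat \<times> bool \<Rightarrow> nat \<times> nat \<Rightarrow> nat \<times> nat" where
  "signed_act x = (if snd x then act (fst x) else inv_into UNIV (act (fst x)))"

lemma fold_signed_act_pos_word: "fold signed_act (pos_word u) = fold act u"
  by (induction u) (auto simp: signed_act_def)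

text \<open>By this invariance the action is one of the presented group.\<close>

lemma signed_act_cong: "(u, v) \<in> word_cong \<Longrightarrow> fold signed_act u = fold signed_act v"
proof (induction rule: pres_cong.induct)
  case (rel u v)
  then show ?case using act_rel by (auto simp: fold_signed_act_pos_word)
next
  case (cancel a b)
  then show ?case
    using bij_act[of a] by (cases b) (auto simp: signed_act_def fun_eq_iff bij_is_inj bij_is_surj surj_f_inv_f)
qed auto

lemma act_eq_of_val_eq:
  "u \<in> words \<Longrightarrow> v \<in> words \<Longrightarrow> val u = val v \<Longrightarrow> fold act u = fold act v"
  using signed_act_cong by (metis val_eq_iff fold_signed_act_pos_word)

lemma act_fixes: "\<forall>i\<in>set u. m < i \<Longrightarrow> m < n \<or> u = [] \<Longrightarrow> fold act u (m, c) = (m, c)"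
  by (induction u) (auto simp: act_def transpose_def)

lemma act_ascending: "m \<le> j \<Longrightarrow> j \<le> n \<Longrightarrow> fold act [m..<j] (m, c) = (j, c)"
  by (induction j rule: dec_induct) (auto simp: act_def)

lemma act_descending: "j \<le> i \<Longrightarrow> i \<le> n \<Longrightarrow> fold act (rev [j..<i]) (i, c) = (j, c)"
  by (induction i rule: dec_induct) (auto simp: act_def)

lemma act_coset_rep:
  assumes "m \<le> j" "j \<le> n" "k < d"
  shows "fold act (coset_rep m j k) (m, 0) = (j, k)"
  using assms by (auto simp: coset_rep_def act_ascending act_descending act_power)

text \<open>
  The image of \<open>(m, 0)\<close> identifies the last representative, which is then cancelled in the
  group; the remaining words are normal of the next level.
\<close>

lemma normal_unique: "normal m a \<Longrightarrow> normal m b \<Longrightarrow> val a = val b \<Longrightarrow> a = b"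
proof (induction arbitrary: b rule: normal.induct)
  case empty
  from empty(1) show ?case by cases auto
next
  case (extend m a j k)
  from extend.prems(1) obtain a' j' k' where b: "b = a' @ coset_rep m j' k'"
    and b': "normal (Suc m) a'" "m \<le> j'" "j' \<le> n" "k' < d"
    using extend.hyps by cases auto
  \<comment> \<open>The higher levels fix \<open>(m, 0)\<close>, so only the last representative moves it.\<close>
  have moves: "fold act (c @ coset_rep m i l) (m, 0) = (i, l)"
    if "normal (Suc m) c" "m \<le> i" "i \<le> n" "l < d" for c i l
  proof -
    have "set c \<subseteq> {Suc m..n}" using normal_letters[OF that(1)] by simp
    then have "fold act c (m, 0) = (m, 0)" by (intro act_fixes) (cases c, auto)+
    then show ?thesis using that by (simp add: act_coset_rep)
  qed
  have aw: "a \<in> words" "a' \<in> words"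
    using normal_letters[OF extend.hyps(1)] normal_letters[OF b'(1)] by auto
  have rw: "coset_rep m j k \<in> words" "coset_rep m j' k' \<in> words"
    using extend.hyps b' coset_rep_words by blast+
  have "fold act (a @ coset_rep m j k) = fold act b"
    using aw rw extend.prems unfolding b by (intro act_eq_of_val_eq) auto
  then have jk: "j = j'" "k = k'"
    using moves[OF extend.hyps(1), of j k] moves[OF b'(1), of j' k'] extend.hyps b' b by auto
  then have "val a = val a'"
    using extend.prems(2) aw rw by (simp add: b val_append val_closed)
  then show ?case using extend.IH[OF b'(1)] b jk by simp
qed

section \<open>Reduced expressions\<close>

lemma reduced_exprs_nonempty:
  assumes "w \<in> carrier (G_group d n)" shows "reduced_exprs d n w \<noteq> {}"
proof -
  obtain u where "u \<in> words \<and> val u = w" using val_onto[OF assms] by blast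
  from ex_has_least_nat[of "\<lambda>u. u \<in> words \<and> val u = w", OF this, of length]
  have "\<exists>u. (u \<in> words \<and> val u = w) \<and> (\<forall>v. v \<in> words \<and> val v = w \<longrightarrow> length u \<le> length v)" .
  then show ?thesis unfolding reduced_exprs_def by blast
qed

lemma reduced_exprs_braid_equiv:
  assumes "u \<in> reduced_exprs d n w" "v \<in> reduced_exprs d n w"
  shows "(u, v) \<in> braid_equiv d n"
proof -
  have to_normal: "\<exists>a. normal 1 a \<and> val a = w \<and> (x, a) \<in> braid_equiv d n"
    if x: "x \<in> reduced_exprs d n w" for x
  proof -
    have xw: "x \<in> words" "val x = w"
      and minimal: "\<And>v. v \<in> words \<Longrightarrow> val v = w \<Longrightarrow> length x \<le> length v"
      using x unfolding reduced_exprs_def by blast+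
    obtain a where a: "normal 1 a" "x \<leadsto> a" using reduces_to_normal[OF xw(1)] by blast
    then have "a \<in> words" "val a = w" "(x, a) \<in> braid_equiv d n \<or> length a < length x"
      using xw(2) by (simp_all add: reduces_def)
    moreover from this have "\<not> length a < length x" using minimal by (simp add: not_less)
    ultimately show ?thesis using a(1) by blast
  qed
  obtain a where a: "normal 1 a" "val a = w" "(u, a) \<in> braid_equiv d n"
    using to_normal[OF assms(1)] by (elim exE conjE)
  obtain b where b: "normal 1 b" "val b = w" "(v, b) \<in> braid_equiv d n"
    using to_normal[OF assms(2)] by (elim exE conjE)
  have "a = b" using a b by (intro normal_unique) simp_all
  with a(3) b(3) have "(u, a) \<in> braid_equiv d n" "(a, v) \<in> braid_equiv d n"
    using equiv_braid_equiv[of n d] by (auto simp: equiv_def dest: symD)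
  then show ?thesis
    using equiv_braid_equiv[of n d] unfolding equiv_def by (elim conjE transE)
qed

end

theorem proposition3p1:
  fixes d n :: nat and w :: "nat sword set"
  assumes "1 \<le> d" and "1 \<le> n"
    and "w \<in> carrier (G_group d n)"
  shows "card (reduced_exprs d n w // braid_equiv d n) = 1"
proof -
  obtain u where u: "u \<in> reduced_exprs d n w"
    using reduced_exprs_nonempty[OF assms] by blast
  have "braid_equiv d n `` {v} = braid_equiv d n `` {u}" if "v \<in> reduced_exprs d n w" for v
    using reduced_exprs_braid_equiv[OF assms(1,2) that u]
    by (rule equiv_class_eq[OF equiv_braid_equiv])
  then have "reduced_exprs d n w // braid_equiv d n = {braid_equiv d n `` {u}}"
    using u unfolding quotient_def by blast
  then show ?thesis by simp
qed

end
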